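(* Define the overlap ratio $$\kappa:=\frac{n_{\mathrm{over}}}{q}\in[0,1],$$ which measures the fraction of the training subspace shared by the two tasks: $\kappa=0$ corresponds to disjoint subspaces, while $\kappa=1$ corresponds to a single shared subspace. For sufficiently small $\alpha$, the leading growth times satisfy $$\frac{t_{\mathrm{over,growth}}}{t_{\mathrm{single,growth}}}\;\approx\;\rho(\kappa):=\frac{1+\kappa}{1+\sqrt\kappa},$$ where $\rho$ has the following properties: (i) (Strict acceleration) $\rho(\kappa)<1$ for every $\kappa\in(0,1)$. (ii) (Optimal diversity) $\rho$ attains its minimum at $\kappa^\star=3-2\sqrt2$, with $\rho(\kappa^\star)=2(\sqrt2-1)$, corresponding to roughly a $17\%$ reduction in the leading growth time.
   Context: Two $r$-dimensional task subspaces of $\mathbb R^d$ intersect in a common subspace of dimension $n_{\mathrm{over}}$, are otherwise mutually orthogonal, and have a sum of dimension $q$; $n_{\mathrm{ind}}:=q-n_{\mathrm{over}}$. A single-layer linear attention model is trained by gradient flow for in-context linear regression from initialization scale $\alpha>0$, with time constant $\tau>0$ (the reciprocal of the learning rate) and a fixed stationarity tolerance $\delta\in(0,q^{-1/6})$. The growth time is the part of the convergence time spent escaping the small-initialization regime. When task vectors are drawn from a single Gaussian supported on the $q$-dimensional sum (single-task), it is $$t_{\mathrm{single,growth}}=\tau\sqrt q\Big(\frac1\alpha-\frac1{q^{-1/6}-\delta}\Big).$$ When task vectors are drawn from an equal mixture of two Gaussians supported on the two task subspaces (task-diverse), the growth time of the stage in which the shared components are learned is, under an ansatz on the dynamics,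 $$t_{\mathrm{over,growth}}=\frac{2\tau a}{\alpha n_{\mathrm{ind}}}\Big(\sqrt q-\sqrt{n_{\mathrm{over}}+\frac{n_{\mathrm{ind}}\alpha}{\lambda^\star_{\mathrm{over}}-\delta}}\Big),\qquad a=\frac{2n_{\mathrm{over}}+n_{\mathrm{ind}}}{2},$$ where $\lambda^\star_{\mathrm{over}}$ is the unique positive root of $n_{\mathrm{over}}\lambda^6+\alpha n_{\mathrm{ind}}\lambda^5-1=0$. The symbol $\approx$ denotes an approximation to leading order for small $\alpha$: lower-order terms in the growth times are neglected and $\lambda^\star_{\mathrm{over}}\approx n_{\mathrm{over}}^{-1/6}$ is used. *)

theory Defs
  imports "HOL-Analysis.Analysis" "HOL-Library.Landau_Symbols"
begin

definition task_subspaces :: "('a::euclidean_space) set \<Rightarrow> 'a set \<Rightarrow> nat \<Rightarrow> bool" where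
  "task_subspaces V W r \<longleftrightarrow>
     subspace V \<and> subspace W \<and> dim V = r \<and> dim W = r \<and>
     (\<forall>x \<in> V \<inter> orthogonal_comp (V \<inter> W). \<forall>y \<in> W \<inter> orthogonal_comp (V \<inter> W). orthogonal x y)"

definition overlap_dim :: "('a::euclidean_space) set \<Rightarrow> 'a set \<Rightarrow> nat" where
  "overlap_dim V W = dim (V \<inter> W)"

definition sum_dim :: "('a::euclidean_space) set \<Rightarrow> 'a set \<Rightarrow> nat" where
  "sum_dim V W = dim {x + y | x y. x \<in> V \<and> y \<in> W}"

definition t_single_growth :: "real \<Rightarrow> real \<Rightarrow> real \<Rightarrow> real \<Rightarrow> real" where
  "t_single_growth \<tau> \<delta> q \<alpha> = \<tau> * sqrt q * (1 / \<alpha> - 1 / (q powr (-1/6) - \<delta>))"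

definition lambda_over :: "real \<Rightarrow> real \<Rightarrow> real \<Rightarrow> real" where
  "lambda_over n_over n_ind \<alpha> =
     (THE l. l > 0 \<and> n_over * l ^ 6 + \<alpha> * n_ind * l ^ 5 - 1 = 0)"

lemma lambda_over_unique:
  fixes n_over n_ind \<alpha> :: real
  assumes "n_over \<ge> 0" "n_ind \<ge> 0" "n_over + n_ind > 0" "\<alpha> > 0"
  shows "\<exists>!l. l > 0 \<and> n_over * l ^ 6 + \<alpha> * n_ind * l ^ 5 - 1 = 0"
proof -
  define b where "b = \<alpha> * n_ind"
  define f where "f = (\<lambda>l::real. n_over * l ^ 6 + b * l ^ 5)"
  have b: "b \<ge> 0"
    using assms unfolding b_def by simp
  have nb: "n_over + b > 0"
  proof (cases "n_over = 0")
    case True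
    with assms show ?thesis by (simp add: b_def)
  next
    case False
    with assms b show ?thesis by linarith
  qed
  have mono: "f x < f y" if "0 \<le> x" "x < y" for x y
  proof (cases "n_over = 0")
    case True
    with nb have "b * x ^ 5 < b * y ^ 5"
      using that by (intro mult_strict_left_mono power_strict_mono) auto
    with True show ?thesis by (simp add: f_def)
  next
    case False
    with assms have "n_over * x ^ 6 < n_over * y ^ 6"
      using that by (intro mult_strict_left_mono power_strict_mono) auto
    moreover have "b * x ^ 5 \<le> b * y ^ 5"
      using that b by (intro mult_left_mono power_mono) auto
    ultimately show ?thesis by (simp add: f_def)
  qed
  define M where "M = 1 + 1 / (n_over + b)"
  have M: "M \<ge> 1" "M * (n_over + b) \<ge> 1"
    using nb by (simp_all add: M_def distrib_right)
  have "M ^ 1 \<le> M ^ 6" "M ^ 1 \<le> M ^ 5" using M by (intro power_increasing; simp)+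
  then have "n_over * M + b * M \<le> f M"
    unfolding f_def using assms b by (intro add_mono mult_left_mono) auto
  then have "f M \<ge> 1" using M by (simp add: algebra_simps)
  moreover have "f 0 \<le> 1" by (simp add: f_def)
  moreover have "continuous_on {0..M} f" unfolding f_def by (intro continuous_intros)
  ultimately obtain l where l: "0 \<le> l" "f l = 1"
    using IVT'[of f 0 1 M] M by auto
  then have "l > 0" by (cases "l = 0") (auto simp: f_def)
  moreover have "x = l" if "x > 0" "f x = 1" for x
    using mono[of x l] mono[of l x] that l by linarith
  ultimately have "\<exists>!l. l > 0 \<and> f l = 1" using l by blast
  then show ?thesis by (simp add: f_def b_def)
qed

definition over_growth_formula :: "real \<Rightarrow> real \<Rightarrow> real \<Rightarrow> real \<Rightarrow> real \<Rightarrow> real" where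
  "over_growth_formula \<tau> \<delta> q n_over \<alpha> =
     (let n_ind = q - n_over; a = (2 * n_over + n_ind) / 2 in
      2 * \<tau> * a / (\<alpha> * n_ind) *
        (sqrt q - sqrt (n_over + n_ind * \<alpha> / (lambda_over n_over n_ind \<alpha> - \<delta>))))"

text \<open>For identical task subspaces, \<open>n_over = q\<close>, the formula reads 0/0 (and HOL's division
  would return 0), so there it is extended continuously, by its limit as \<open>n_over\<close> increases
  to \<open>q\<close>.\<close>

definition t_over_growth :: "real \<Rightarrow> real \<Rightarrow> real \<Rightarrow> real \<Rightarrow> real \<Rightarrow> real" where
  "t_over_growth \<tau> \<delta> q n_over \<alpha> =
     (if n_over = q then Lim (at_left q) (\<lambda>m. over_growth_formula \<tau> \<delta> q m \<alpha>)
      else over_growth_formula \<tau> \<delta> q n_over \<alpha>)"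

definition overlap_ratio :: "('a::euclidean_space) set \<Rightarrow> 'a set \<Rightarrow> real" where
  "overlap_ratio V W = real (overlap_dim V W) / real (sum_dim V W)"

definition \<rho> :: "real \<Rightarrow> real" where
  "\<rho> \<kappa> = (1 + \<kappa>) / (1 + sqrt \<kappa>)"

end

theory Submission
  imports Defs
begin

text \<open>Rationalising \<open>\<surd>q - \<surd>X\<close> with \<open>X = n_over + n_ind \<alpha> / (\<lambda> - \<delta>)\<close> cancels the factor
  \<open>n_ind\<close> in the growth formula, so that it becomes
  \<open>(\<tau> / \<alpha>) (q + n_over) (1 - \<alpha> / (\<lambda> - \<delta>)) / (\<surd>q + \<surd>X)\<close>. The left side of the equation of
  \<open>\<lambda>\<close> is increasing and, for small \<open>\<alpha>\<close>, less than 1 at any given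
  nonnegative point below \<open>q powr (-1/6)\<close>;
  hence \<open>\<lambda> - \<delta>\<close> stays away from 0, \<open>X\<close> tends to \<open>n_over\<close>, and the ratio to \<open>\<rho> \<kappa>\<close>. At
  \<open>n_over = q\<close> the continuous extension is exactly the single-task time. The properties of
  \<open>\<rho>\<close> follow from \<open>1 + s\<^sup>2 - 2 (\<surd>2 - 1) (1 + s) = (s - (\<surd>2 - 1))\<^sup>2\<close> with \<open>s = \<surd>\<kappa>\<close>.\<close>

section \<open>Comparison principle for the root \<open>lambda_over\<close>\<close>

lemma lambda_over_root:
  fixes n_over n_ind \<alpha> :: real
  assumes "n_over \<ge> 0" "n_ind \<ge> 0" "n_over + n_ind > 0" "\<alpha> > 0"
  shows "lambda_over n_over n_ind \<alpha> > 0"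
    and "n_over * lambda_over n_over n_ind \<alpha> ^ 6 + \<alpha> * n_ind * lambda_over n_over n_ind \<alpha> ^ 5 = 1"
  using theI'[OF lambda_over_unique[OF assms]] unfolding lambda_over_def by auto

lemma lambda_over_poly_mono:
  fixes m b x y :: real
  assumes "m \<ge> 0" "b \<ge> 0" "0 \<le> x" "x \<le> y"
  shows "m * x ^ 6 + b * x ^ 5 \<le> m * y ^ 6 + b * y ^ 5"
  using assms by (intro add_mono mult_left_mono power_mono) auto

text \<open>Otherwise \<open>c\<close> would lie at or above the positive root, and monotonicity
  would push the value at \<open>c\<close> up to at least 1. Bounds on the root thus reduce to
  evaluating the polynomial at a test point.\<close>

lemma less_lambda_over:
  assumes "n_over \<ge> 0" "n_ind \<ge> 0" "n_over + n_ind > 0" "\<alpha> > 0"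
    and "n_over * c ^ 6 + \<alpha> * n_ind * c ^ 5 < 1"
  shows "c < lambda_over n_over n_ind \<alpha>"
proof (rule ccontr)
  assume "\<not> ?thesis"
  with lambda_over_poly_mono[of n_over "\<alpha> * n_ind" "lambda_over n_over n_ind \<alpha>" c]
    lambda_over_root[OF assms(1-4)] assms show False by auto
qed

lemma lambda_over_less:
  assumes "n_over \<ge> 0" "n_ind \<ge> 0" "n_over + n_ind > 0" "\<alpha> > 0" "c \<ge> 0"
    and "n_over * c ^ 6 + \<alpha> * n_ind * c ^ 5 > 1"
  shows "lambda_over n_over n_ind \<alpha> < c"
proof (rule ccontr)
  assume "\<not> ?thesis"
  with lambda_over_poly_mono[of n_over "\<alpha> * n_ind" c "lambda_over n_over n_ind \<alpha>"]
    lambda_over_root[OF assms(1-4)] assms show False by auto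
qed

section \<open>The limit value \<open>q powr (-1/6)\<close> of the root\<close>

lemma powr_neg_sixth_power:
  fixes q :: real
  assumes "q > 0"
  shows "q * (q powr (-1/6)) ^ 6 = 1"
proof -
  have "(q powr (-1/6)) ^ 6 = q powr (-1)"
    using assms by (subst powr_power) auto
  then show ?thesis using assms by (simp add: powr_minus)
qed

lemma mult_power6_less_1_iff:
  fixes q c :: real
  assumes "q > 0" "c \<ge> 0"
  shows "q * c ^ 6 < 1 \<longleftrightarrow> c < q powr (-1/6)"
proof -
  have "q * c ^ 6 < 1 \<longleftrightarrow> q * c ^ 6 < q * (q powr (-1/6)) ^ 6"
    using powr_neg_sixth_power[OF assms(1)] by simp
  also have "\<dots> \<longleftrightarrow> c < q powr (-1/6)"
    using assms power_less_imp_less_base[of c 6 "q powr (-1/6)"] power_strict_mono[of c "q powr (-1/6)" 6] by auto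
  finally show ?thesis .
qed

lemma mult_power6_greater_1_iff:
  fixes q c :: real
  assumes "q > 0" "c \<ge> 0"
  shows "q * c ^ 6 > 1 \<longleftrightarrow> c > q powr (-1/6)"
proof -
  have "q * c ^ 6 > 1 \<longleftrightarrow> q * c ^ 6 > q * (q powr (-1/6)) ^ 6"
    using powr_neg_sixth_power[OF assms(1)] by simp
  also have "\<dots> \<longleftrightarrow> c > q powr (-1/6)"
    using assms power_less_imp_less_base[of "q powr (-1/6)" 6 c] power_strict_mono[of "q powr (-1/6)" c 6] by auto
  finally show ?thesis .
qed

lemma eventually_at_left_nonneg_less:
  fixes q :: real
  assumes "q > 0"
  shows "eventually (\<lambda>m. 0 \<le> m \<and> m < q) (at_left q)"
  using eventually_at_left_real[OF assms] by eventually_elim auto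

text \<open>At \<open>m = q\<close> the fifth-degree term vanishes and the equation degenerates to
  \<open>q * l ^ 6 = 1\<close>. Test points on either side of the solution trap the root.\<close>

lemma tendsto_lambda_over_at_left:
  fixes q \<alpha> :: real
  assumes q: "q > 0" and \<alpha>: "\<alpha> > 0"
  shows "((\<lambda>m. lambda_over m (q - m) \<alpha>) \<longlongrightarrow> q powr (-1/6)) (at_left q)"
proof -
  have lim: "((\<lambda>m. m * c ^ 6 + \<alpha> * (q - m) * c ^ 5) \<longlongrightarrow> q * c ^ 6) (at_left q)" for c
    by (rule tendsto_eq_intros refl | simp)+
  show ?thesis
  proof (rule order_tendstoI)
    fix c assume c: "c < q powr (-1/6)"
    \<comment> \<open>A negative \<open>c\<close> may have a large sixth power, so the test point is
      truncated at 0.\<close>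
    define c' where "c' = max c 0"
    have "q * c' ^ 6 < 1"
      using c q by (subst mult_power6_less_1_iff) (auto simp: c'_def)
    from order_tendstoD(2)[OF lim this] eventually_at_left_nonneg_less[OF q]
    show "eventually (\<lambda>m. c < lambda_over m (q - m) \<alpha>) (at_left q)"
    proof eventually_elim
      case (elim m)
      then have "c' < lambda_over m (q - m) \<alpha>"
        using q \<alpha> by (intro less_lambda_over) auto
      then show ?case by (simp add: c'_def)
    qed
  next
    fix c assume c: "c > q powr (-1/6)"
    then have c0: "c \<ge> 0"
      by (meson less_eq_real_def order_trans powr_ge_zero)
    with c q have "q * c ^ 6 > 1"
      by (subst mult_power6_greater_1_iff) auto
    from order_tendstoD(1)[OF lim this] eventually_at_left_nonneg_less[OF q]
    show "eventually (\<lambda>m. lambda_over m (q - m) \<alpha> < c) (at_left q)"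
      by eventually_elim (use q \<alpha> c0 in \<open>auto intro!: lambda_over_less\<close>)
  qed
qed

section \<open>Growth time without the removable singularity\<close>

lemma over_growth_formula_eq:
  fixes q m \<alpha> \<tau> \<delta> :: real
  defines "l \<equiv> lambda_over m (q - m) \<alpha>"
  assumes m: "0 \<le> m" "m < q" and \<alpha>: "\<alpha> > 0" and l: "l > \<delta>"
  shows "over_growth_formula \<tau> \<delta> q m \<alpha> =
    \<tau> / \<alpha> * (q + m) * (1 - \<alpha> / (l - \<delta>)) / (sqrt q + sqrt (m + (q - m) * \<alpha> / (l - \<delta>)))"
proof -
  define X where "X = m + (q - m) * \<alpha> / (l - \<delta>)"
  have X: "X \<ge> 0"
    unfolding X_def using m \<alpha> l by (intro add_nonneg_nonneg divide_nonneg_pos mult_nonneg_nonneg) auto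
  have "sqrt q > 0" using m by simp
  then have pos: "sqrt q + sqrt X > 0" using X by (simp add: add_pos_nonneg)
  have "(sqrt q - sqrt X) * (sqrt q + sqrt X) = q - X"
    using X m by (simp add: algebra_simps)
  also have "\<dots> = (q - m) * (1 - \<alpha> / (l - \<delta>))"
    by (simp add: X_def algebra_simps)
  finally have "sqrt q - sqrt X = (q - m) * (1 - \<alpha> / (l - \<delta>)) / (sqrt q + sqrt X)"
    using pos by (simp add: eq_divide_eq)
  moreover have "over_growth_formula \<tau> \<delta> q m \<alpha> =
      \<tau> * (q + m) / (\<alpha> * (q - m)) * (sqrt q - sqrt X)"
    by (simp add: over_growth_formula_def X_def l_def Let_def)
  moreover have "q - m \<noteq> 0" using m by simp
  ultimately show ?thesis
    unfolding X_def[symmetric] by simp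
qed

text \<open>As \<open>m\<close> tends to \<open>q\<close> the radicand tends to \<open>q\<close>, so
  the denominator becomes \<open>2 * sqrt q\<close> against a numerator factor \<open>2 * q\<close>.
  The equality is exact for every \<alpha> > 0, not merely asymptotic.\<close>

lemma t_over_growth_identical:
  fixes q \<alpha> \<tau> \<delta> :: real
  assumes q: "q > 0" and \<alpha>: "\<alpha> > 0" and \<delta>: "\<delta> < q powr (-1/6)"
  shows "t_over_growth \<tau> \<delta> q q \<alpha> = t_single_growth \<tau> \<delta> q \<alpha>"
proof -
  define L where "L = q powr (-1/6)"
  define l where "l = (\<lambda>m. lambda_over m (q - m) \<alpha>)"
  define g where "g = (\<lambda>m. \<tau> / \<alpha> * (q + m) * (1 - \<alpha> / (l m - \<delta>)) /
    (sqrt q + sqrt (m + (q - m) * \<alpha> / (l m - \<delta>))))"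
  have l: "(l \<longlongrightarrow> L) (at_left q)"
    unfolding l_def L_def by (rule tendsto_lambda_over_at_left[OF q \<alpha>])
  have L: "L - \<delta> \<noteq> 0" using \<delta> by (simp add: L_def)
  have double: "x * (q + q) * y / (s + s) = x * y * (q / s)" for x y s :: real
    by (simp flip: mult_2)
  have "(g \<longlongrightarrow> \<tau> / \<alpha> * (q + q) * (1 - \<alpha> / (L - \<delta>)) /
      (sqrt q + sqrt (q + (q - q) * \<alpha> / (L - \<delta>)))) (at_left q)"
    unfolding g_def using q L by (intro tendsto_intros l) auto
  also have "\<tau> / \<alpha> * (q + q) * (1 - \<alpha> / (L - \<delta>)) / (sqrt q + sqrt (q + (q - q) * \<alpha> / (L - \<delta>)))
      = \<tau> / \<alpha> * (1 - \<alpha> / (L - \<delta>)) * (q / sqrt q)"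
    using double[of "\<tau> / \<alpha>" "1 - \<alpha> / (L - \<delta>)" "sqrt q"] by simp
  also have "\<dots> = \<tau> / \<alpha> * (1 - \<alpha> / (L - \<delta>)) * sqrt q"
    using q by (simp add: real_div_sqrt)
  also have "\<dots> = t_single_growth \<tau> \<delta> q \<alpha>"
    using \<alpha> by (simp add: t_single_growth_def L_def right_diff_distrib left_diff_distrib)
  finally have lim: "(g \<longlongrightarrow> t_single_growth \<tau> \<delta> q \<alpha>) (at_left q)" .
  have "eventually (\<lambda>m. g m = over_growth_formula \<tau> \<delta> q m \<alpha>) (at_left q)"
    using order_tendstoD(1)[OF l \<delta>[folded L_def]] eventually_at_left_nonneg_less[OF q]
    by eventually_elim (use \<alpha> in \<open>simp add: over_growth_formula_eq g_def l_def\<close>)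
  with lim have "((\<lambda>m. over_growth_formula \<tau> \<delta> q m \<alpha>) \<longlongrightarrow> t_single_growth \<tau> \<delta> q \<alpha>) (at_left q)"
    by (rule Lim_transform_eventually)
  then show ?thesis
    by (simp add: t_over_growth_def tendsto_Lim)
qed

section \<open>Limit of the growth ratio for small \<alpha>\<close>

text \<open>A fixed \<open>c\<close> strictly between \<delta> and \<open>q powr (-1/6)\<close>
  eventually lies below the root, so the gap stays above \<open>c - \<delta>\<close>. A lower bound
  suits all \<open>m\<close> at once: for \<open>m = 0\<close> the root itself diverges.\<close>

lemma tendsto_alpha_over_lambda_gap:
  fixes q m \<delta> :: real
  assumes m: "0 \<le> m" "m < q" and \<delta>: "0 < \<delta>" "\<delta> < q powr (-1/6)"
  shows "eventually (\<lambda>\<alpha>. \<delta> < lambda_over m (q - m) \<alpha>) (at_right 0)"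
    and "((\<lambda>\<alpha>. \<alpha> / (lambda_over m (q - m) \<alpha> - \<delta>)) \<longlongrightarrow> 0) (at_right 0)"
proof -
  have q: "q > 0" using m by simp
  obtain c where c: "\<delta> < c" "c < q powr (-1/6)" using dense[OF \<delta>(2)] by blast
  then have "q * c ^ 6 < 1"
    using q \<delta> by (subst mult_power6_less_1_iff) auto
  moreover have "m * c ^ 6 \<le> q * c ^ 6"
    using m by (intro mult_right_mono) auto
  ultimately have mc: "m * c ^ 6 < 1" by linarith
  have "((\<lambda>\<alpha>. m * c ^ 6 + \<alpha> * (q - m) * c ^ 5) \<longlongrightarrow> m * c ^ 6) (at_right 0)"
    by (rule tendsto_eq_intros refl | simp)+
  from order_tendstoD(2)[OF this mc] eventually_at_right_less[of 0]
  have ev: "eventually (\<lambda>\<alpha>. \<alpha> > 0 \<and> c < lambda_over m (q - m) \<alpha>) (at_right 0)"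
    by eventually_elim (use m in \<open>auto intro!: less_lambda_over\<close>)
  then show "eventually (\<lambda>\<alpha>. \<delta> < lambda_over m (q - m) \<alpha>) (at_right 0)"
    by eventually_elim (use c in auto)
  show "((\<lambda>\<alpha>. \<alpha> / (lambda_over m (q - m) \<alpha> - \<delta>)) \<longlongrightarrow> 0) (at_right 0)"
  proof (rule tendsto_sandwich)
    show "eventually (\<lambda>\<alpha>. 0 \<le> \<alpha> / (lambda_over m (q - m) \<alpha> - \<delta>)) (at_right 0)"
      using ev by eventually_elim (use c in auto)
    show "eventually (\<lambda>\<alpha>. \<alpha> / (lambda_over m (q - m) \<alpha> - \<delta>) \<le> \<alpha> / (c - \<delta>)) (at_right 0)"
      using ev by eventually_elim (use c in \<open>auto intro!: divide_left_mono\<close>)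
    show "((\<lambda>\<alpha>. \<alpha> / (c - \<delta>)) \<longlongrightarrow> 0) (at_right 0)"
      using c by (auto intro!: tendsto_eq_intros)
  qed simp
qed

lemma \<rho>_divide:
  assumes "0 \<le> m" "0 < q"
  shows "\<rho> (m / q) = (q + m) / (sqrt q * (sqrt q + sqrt m))"
proof -
  have "sqrt q > 0" "sqrt m \<ge> 0" using assms by auto
  then have "\<rho> (m / q) = (q * (1 + m / q)) / ((sqrt q * sqrt q) * (1 + sqrt m / sqrt q))"
    using assms by (simp add: \<rho>_def real_sqrt_divide)
  also have "q * (1 + m / q) = q + m"
    using assms by (simp add: distrib_left)
  also have "(sqrt q * sqrt q) * (1 + sqrt m / sqrt q) = sqrt q * (sqrt q + sqrt m)"
    using \<open>sqrt q > 0\<close> by (simp only: mult.assoc distrib_left) simp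
  finally show ?thesis .
qed

lemma tendsto_growth_ratio:
  fixes q m \<tau> \<delta> :: real
  assumes m: "0 \<le> m" "m \<le> q" and q: "q > 0" and \<tau>: "\<tau> > 0"
    and \<delta>: "0 < \<delta>" "\<delta> < q powr (-1/6)"
  shows "((\<lambda>\<alpha>. t_over_growth \<tau> \<delta> q m \<alpha> / t_single_growth \<tau> \<delta> q \<alpha>) \<longlongrightarrow> \<rho> (m / q)) (at_right 0)"
proof -
  define L where "L = q powr (-1/6) - \<delta>"
  have L: "L > 0" using \<delta> by (simp add: L_def)
  \<comment> \<open>The factor \<open>\<tau> / \<alpha>\<close> is pulled out so that it cancels
    against the one in \<open>over_growth_formula_eq\<close>.\<close>
  have single: "t_single_growth \<tau> \<delta> q \<alpha> = \<tau> / \<alpha> * (sqrt q * (1 - \<alpha> / L))" if "\<alpha> > 0" for \<alpha>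
    using that by (simp add: t_single_growth_def L_def field_simps)
  show ?thesis
  proof (cases "m = q")
    case True
    \<comment> \<open>The bound \<open>\<alpha> < L\<close> makes the single-task time nonzero, so
      that the quotient of equal times is 1 and not the default value 0.\<close>
    have "eventually (\<lambda>\<alpha>. 0 < \<alpha> \<and> \<alpha> < L) (at_right 0)"
      using eventually_at_right_real[OF L] by eventually_elim auto
    then have "eventually (\<lambda>\<alpha>. 1 = t_over_growth \<tau> \<delta> q m \<alpha> / t_single_growth \<tau> \<delta> q \<alpha>) (at_right 0)"
      by eventually_elim (use True q \<tau> \<delta> L in \<open>auto simp: t_over_growth_identical single\<close>)
    moreover have "\<rho> (m / q) = 1" using True q by (simp add: \<rho>_def)
    ultimately show ?thesis by (auto intro: Lim_transform_eventually[OF tendsto_const])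
  next
    case False
    with m have mq: "m < q" by simp
    define h where "h = (\<lambda>\<alpha>. \<alpha> / (lambda_over m (q - m) \<alpha> - \<delta>))"
    define g where "g = (\<lambda>\<alpha>. (q + m) * (1 - h \<alpha>) /
      (sqrt q + sqrt (m + (q - m) * h \<alpha>)) / (sqrt q * (1 - \<alpha> / L)))"
    have h: "(h \<longlongrightarrow> 0) (at_right 0)"
      unfolding h_def by (rule tendsto_alpha_over_lambda_gap[OF m(1) mq \<delta>])
    have sq: "sqrt q + sqrt m > 0" using m q by (simp add: add_pos_nonneg)
    have "(g \<longlongrightarrow> (q + m) * (1 - 0) / (sqrt q + sqrt (m + (q - m) * 0)) / (sqrt q * (1 - 0 / L)))
        (at_right 0)"
      unfolding g_def using L q sq by (intro tendsto_intros h) auto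
    also have "(q + m) * (1 - 0) / (sqrt q + sqrt (m + (q - m) * 0)) / (sqrt q * (1 - 0 / L)) = \<rho> (m / q)"
      using m q by (simp add: \<rho>_divide mult.commute)
    finally have lim: "(g \<longlongrightarrow> \<rho> (m / q)) (at_right 0)" .
    have "eventually (\<lambda>\<alpha>. g \<alpha> = t_over_growth \<tau> \<delta> q m \<alpha> / t_single_growth \<tau> \<delta> q \<alpha>) (at_right 0)"
      using tendsto_alpha_over_lambda_gap(1)[OF m(1) mq \<delta>] eventually_at_right_less[of 0]
    proof eventually_elim
      case (elim \<alpha>)
      have "t_over_growth \<tau> \<delta> q m \<alpha> =
          \<tau> / \<alpha> * ((q + m) * (1 - h \<alpha>) / (sqrt q + sqrt (m + (q - m) * h \<alpha>)))"
        using elim m mq by (simp add: t_over_growth_def over_growth_formula_eq h_def)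
      then show ?case
        using elim \<tau> by (simp add: single g_def)
    qed
    with lim show ?thesis by (rule Lim_transform_eventually)
  qed
qed

section \<open>Properties of \<rho>\<close>

lemma \<rho>_less_1:
  assumes "0 < k" "k < 1"
  shows "\<rho> k < 1"
proof -
  have "k < sqrt k" using assms by (intro real_less_rsqrt) (simp add: power2_eq_square)
  then show ?thesis using assms by (simp add: \<rho>_def add_pos_pos)
qed

text \<open>The constant is the one for which the quadratic in \<open>s\<close> has a double root.
  That root, \<open>sqrt 2 - 1\<close>, squares to the minimiser
  \<open>3 - 2 * sqrt 2\<close>.\<close>

lemma \<rho>_lower_bound:
  assumes "k \<ge> 0"
  shows "2 * (sqrt 2 - 1) \<le> \<rho> k"
proof -
  define s where "s = sqrt k"
  have s: "s \<ge> 0" "s\<^sup>2 = k" using assms by (auto simp: s_def)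
  have "1 + s\<^sup>2 - 2 * (sqrt 2 - 1) * (1 + s) = (s - (sqrt 2 - 1))\<^sup>2"
    by (simp add: power2_eq_square algebra_simps)
  then have "2 * (sqrt 2 - 1) * (1 + s) \<le> 1 + k"
    using s zero_le_power2[of "s - (sqrt 2 - 1)"] by linarith
  with s show ?thesis by (simp add: \<rho>_def s_def[symmetric] le_divide_eq)
qed

lemma \<rho>_minimum: "\<rho> (3 - 2 * sqrt 2) = 2 * (sqrt 2 - 1)"
proof -
  have "3 - 2 * sqrt 2 = (sqrt 2 - 1)\<^sup>2"
    by (simp add: power2_eq_square algebra_simps)
  then have "sqrt (3 - 2 * sqrt 2) = sqrt 2 - 1" by simp
  then show ?thesis by (simp add: \<rho>_def field_simps)
qed

section \<open>Dimensions of the task subspaces and conclusion\<close>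

lemma task_subspaces_dims:
  fixes V W :: "('a::euclidean_space) set"
  assumes "task_subspaces V W r"
  shows "sum_dim V W + overlap_dim V W = 2 * r"
    and "overlap_dim V W \<le> r"
    and "overlap_dim V W = 0 \<longleftrightarrow> V \<inter> W = {0}"
    and "overlap_dim V W = r \<longleftrightarrow> V = W"
proof -
  have V: "subspace V" "dim V = r" and W: "subspace W" "dim W = r"
    using assms by (auto simp: task_subspaces_def)
  have VW: "subspace (V \<inter> W)" using V W by (simp add: subspace_inter)
  show "sum_dim V W + overlap_dim V W = 2 * r"
    using dim_sums_Int[OF V(1) W(1)] V W by (simp add: sum_dim_def overlap_dim_def)
  show "overlap_dim V W \<le> r"
    using V dim_subset[of "V \<inter> W" V] by (simp add: overlap_dim_def)
  show "overlap_dim V W = 0 \<longleftrightarrow> V \<inter> W = {0}"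
    using subspace_0[OF VW] by (auto simp: overlap_dim_def dim_eq_0)
  show "overlap_dim V W = r \<longleftrightarrow> V = W"
  proof
    assume "overlap_dim V W = r"
    then have "V \<inter> W = V" "V \<inter> W = W"
      using subspace_dim_equal[OF VW V(1)] subspace_dim_equal[OF VW W(1)] V W
      by (auto simp only: overlap_dim_def)
    then show "V = W" by blast
  qed (use V in \<open>simp add: overlap_dim_def\<close>)
qed

theorem mainTheorem2:
  fixes V W :: "(real ^ 'd) set" and r n_over q :: nat and \<tau> \<delta> \<kappa> :: real
  assumes "task_subspaces V W r" and "r \<ge> 1"
    and "n_over = overlap_dim V W" and "q = sum_dim V W"
    and "\<kappa> = overlap_ratio V W"
    and "\<tau> > 0" and "0 < \<delta>" and "\<delta> < real q powr (-1/6)"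
  shows "\<kappa> \<in> {0..1} \<and> (\<kappa> = 0 \<longleftrightarrow> V \<inter> W = {0}) \<and> (\<kappa> = 1 \<longleftrightarrow> V = W) \<and>
    asymp_equiv (\<lambda>\<alpha>. t_over_growth \<tau> \<delta> (real q) (real n_over) \<alpha> / t_single_growth \<tau> \<delta> (real q) \<alpha>)
      (at_right 0) (\<lambda>\<alpha>. \<rho> \<kappa>) \<and>
    (\<forall>k \<in> {0<..<1}. \<rho> k < 1) \<and>
    is_arg_min \<rho> (\<lambda>k. k \<in> {0..1}) (3 - 2 * sqrt 2) \<and>
    \<rho> (3 - 2 * sqrt 2) = 2 * (sqrt 2 - 1) \<and>
    \<bar>(1 - \<rho> (3 - 2 * sqrt 2)) - 17 / 100\<bar> < 5 / 1000"
proof -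
  note dims = task_subspaces_dims[OF assms(1), folded assms(3,4)]
  \<comment> \<open>Since \<open>q = 2 * r - n_over\<close> and \<open>n_over \<le> r\<close>, it
    follows that \<open>q \<ge> r\<close>.\<close>
  have le: "n_over \<le> q" and q: "q > 0" using dims(1,2) assms(2) by linarith+
  have \<kappa>: "\<kappa> = real n_over / real q" using assms by (simp add: overlap_ratio_def)
  have "\<kappa> \<in> {0..1}" using le q by (simp add: \<kappa>)
  moreover have "\<kappa> = 0 \<longleftrightarrow> V \<inter> W = {0}" using q dims(3) by (simp add: \<kappa>)
  moreover have "\<kappa> = 1 \<longleftrightarrow> V = W"
  proof -
    have "\<kappa> = 1 \<longleftrightarrow> n_over = q" using q by (auto simp: \<kappa>)
    also have "\<dots> \<longleftrightarrow> n_over = r" using dims(1) by linarith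
    finally show ?thesis using dims(4) by simp
  qed
  moreover have "asymp_equiv
      (\<lambda>\<alpha>. t_over_growth \<tau> \<delta> (real q) (real n_over) \<alpha> / t_single_growth \<tau> \<delta> (real q) \<alpha>)
      (at_right 0) (\<lambda>\<alpha>. \<rho> \<kappa>)"
  proof (rule tendsto_imp_asymp_equiv_const)
    show "((\<lambda>\<alpha>. t_over_growth \<tau> \<delta> (real q) (real n_over) \<alpha> / t_single_growth \<tau> \<delta> (real q) \<alpha>)
        \<longlongrightarrow> \<rho> \<kappa>) (at_right 0)"
      unfolding \<kappa> using le q assms by (intro tendsto_growth_ratio) auto
    \<comment> \<open>Convergence to a constant yields asymptotic equivalence once the constant is
      nonzero; the minimum of \<rho> supplies this.\<close>
    have "0 < 2 * (sqrt 2 - 1)" by simp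
    also have "\<dots> \<le> \<rho> \<kappa>" by (rule \<rho>_lower_bound) (simp add: \<kappa>)
    finally show "\<rho> \<kappa> \<noteq> 0" by simp
  qed
  moreover have "\<forall>k \<in> {0<..<1}. \<rho> k < 1" by (simp add: \<rho>_less_1)
  \<comment> \<open>The reduction equals \<open>3 - 2 * sqrt 2\<close>, so the stated tolerance
    amounts to \<open>1.4125 < sqrt 2 < 1.4175\<close>. The same bounds place the minimiser in the
    unit interval.\<close>
  moreover have sqrt2: "1413 / 1000 < sqrt 2" "sqrt 2 < 1417 / 1000"
    by (rule real_less_rsqrt real_less_lsqrt; simp add: power2_eq_square)+
  moreover have "is_arg_min \<rho> (\<lambda>k. k \<in> {0..1}) (3 - 2 * sqrt 2)"
    using sqrt2 \<rho>_lower_bound by (auto simp: is_arg_min_def \<rho>_minimum not_less)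
  moreover have "\<bar>(1 - \<rho> (3 - 2 * sqrt 2)) - 17 / 100\<bar> < 5 / 1000"
    unfolding \<rho>_minimum abs_less_iff
    using sqrt2 by (simp add: field_simps)
  ultimately show ?thesis using \<rho>_minimum by blast
qed

end
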